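(* Let $P$ and $Q$ be probability distributions on a measurable space $(\mathcal{X},\mathcal{F})$. For any $\alpha\in(0,1)\cup(1,\infty)$, $$(1-\alpha)D_\alpha(P\|Q)=\inf_R\big\{\alpha D(R\|P)+(1-\alpha)D(R\|Q)\big\},$$ where the infimum is over all probability distributions $R$ on $(\mathcal{X},\mathcal{F})$, with the convention that $\alpha D(R\|P)+(1-\alpha)D(R\|Q)=\infty$ if it would otherwise be undefined. Moreover, if the distribution $P_\alpha$ with density $$p_\alpha=\frac{q^{1-\alpha}p^\alpha}{\int q^{1-\alpha}p^\alpha\,d\mu}$$ is well defined (i.e. $0<\int p^\alpha q^{1-\alpha}\,d\mu<\infty$), and in addition $\alpha\in(0,1)$ or $D(P_\alpha\|P)<\infty$, then the infimum is uniquely achieved by $R=P_\alpha$.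
   Context: $\mu$ is a $\sigma$-finite measure dominating $P$ and $Q$ (its choice is immaterial), and $p,q$ are the densities of $P,Q$ with respect to $\mu$. Rényi divergence: for $\alpha\in(0,1)\cup(1,\infty)$, $D_\alpha(P\|Q)=\frac{1}{\alpha-1}\ln\int p^\alpha q^{1-\alpha}\,d\mu\in[0,\infty]$, where for $\alpha>1$ one reads $p^\alpha q^{1-\alpha}$ as $p^\alpha/q^{\alpha-1}$ with the conventions $0/0=0$ and $x/0=\infty$ for $x>0$. $D(P\|Q)=\int p\ln\frac{p}{q}\,d\mu\in[0,\infty]$ is the Kullback-Leibler divergence, with the conventions $0\ln(0/q)=0$ and $p\ln(p/0)=\infty$ if $p>0$; in particular $D(P\|Q)=\infty$ if $P\not\ll Q$. *)

theory Defs
  imports "HOL-Probability.Probability"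
begin

definition sum_measure :: "'a measure \<Rightarrow> 'a measure \<Rightarrow> 'a measure" where
  "sum_measure M N = measure_of (space M) (sets M) (\<lambda>A. emeasure M A + emeasure N A)"

definition ln_ennreal :: "ennreal \<Rightarrow> ereal" where
  "ln_ennreal x = (if x = 0 then - \<infinity> else if x = \<infinity> then \<infinity> else ereal (ln (enn2real x)))"

(* For a > 1 this is p^a / q^(a-1). Division in ennreal satisfies 0 / 0 = 0 and
   x / 0 = \<infinity> for x > 0. *)
definition renyi_integrand :: "real \<Rightarrow> real \<Rightarrow> real \<Rightarrow> ennreal" where
  "renyi_integrand a p q =
     (if a < 1 then ennreal (p powr a * q powr (1 - a))
      else ennreal (p powr a) / ennreal (q powr (a - 1)))"

definition kl_integrand :: "real \<Rightarrow> real \<Rightarrow> ereal" where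
  "kl_integrand p q = (if p = 0 then 0 else if q = 0 then \<infinity> else ereal (p * ln (p / q)))"

definition renyi_integral :: "'a measure \<Rightarrow> real \<Rightarrow> ('a \<Rightarrow> real) \<Rightarrow> ('a \<Rightarrow> real) \<Rightarrow> ennreal" where
  "renyi_integral \<mu> a p q = (\<integral>\<^sup>+ x. renyi_integrand a (p x) (q x) \<partial>\<mu>)"

(* Integral of the positive part minus integral of the negative part; e2ennreal maps negative
   numbers to 0. For probability densities the negative part always has a finite integral
   (at most 1), because p ln (p / q) \<ge> p - q. *)
definition kl_integral :: "'a measure \<Rightarrow> ('a \<Rightarrow> real) \<Rightarrow> ('a \<Rightarrow> real) \<Rightarrow> ereal" where
  "kl_integral \<mu> p q =
     enn2ereal (\<integral>\<^sup>+ x. e2ennreal (kl_integrand (p x) (q x)) \<partial>\<mu>) -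
     enn2ereal (\<integral>\<^sup>+ x. e2ennreal (- kl_integrand (p x) (q x)) \<partial>\<mu>)"

(* The dominating measure in the two divergences is taken to be P + Q. Lemmas
   renyi_divergence_eq and kl_divergence_eq below show that any other sigma-finite dominating
   measure, and any choice of densities, gives the same values. The library constant
   KL_divergence is real-valued and cannot take the value \<infinity>, so it is not used. *)
definition renyi_divergence :: "real \<Rightarrow> 'a measure \<Rightarrow> 'a measure \<Rightarrow> ereal" where
  "renyi_divergence a P Q =
     (let \<mu> = sum_measure P Q in
      ereal (1 / (a - 1)) *
      ln_ennreal (renyi_integral \<mu> a (\<lambda>x. enn2real (RN_deriv \<mu> P x)) (\<lambda>x. enn2real (RN_deriv \<mu> Q x))))"

definition kl_divergence :: "'a measure \<Rightarrow> 'a measure \<Rightarrow> ereal" where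
  "kl_divergence P Q =
     (let \<mu> = sum_measure P Q in
      kl_integral \<mu> (\<lambda>x. enn2real (RN_deriv \<mu> P x)) (\<lambda>x. enn2real (RN_deriv \<mu> Q x)))"

definition kl_mixture :: "real \<Rightarrow> 'a measure \<Rightarrow> 'a measure \<Rightarrow> 'a measure \<Rightarrow> ereal" where
  "kl_mixture a P Q R =
     (let u = ereal a * kl_divergence R P; v = ereal (1 - a) * kl_divergence R Q in
      if u = \<infinity> \<and> v = - \<infinity> \<or> u = - \<infinity> \<and> v = \<infinity> then \<infinity> else u + v)"

definition tilted_distribution ::
    "'a measure \<Rightarrow> real \<Rightarrow> ('a \<Rightarrow> real) \<Rightarrow> ('a \<Rightarrow> real) \<Rightarrow> 'a measure" where
  "tilted_distribution \<mu> a p q =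
     density \<mu> (\<lambda>x. renyi_integrand a (p x) (q x) / renyi_integral \<mu> a p q)"


lemma sets_sum_measure [simp]: "sets (sum_measure M N) = sets M"
  and space_sum_measure [simp]: "space (sum_measure M N) = space M"
  by (simp_all add: sum_measure_def sets.sets_measure_of_eq sets.space_measure_of_eq)

lemma emeasure_sum_measure:
  assumes "sets N = sets M" "A \<in> sets M"
  shows "emeasure (sum_measure M N) A = emeasure M A + emeasure N A"
proof (rule emeasure_measure_of[OF sum_measure_def])
  show "sets M \<subseteq> Pow (space M)" by (rule sets.space_closed)
  show "A \<in> sets (sum_measure M N)" using assms by simp
  show "positive (sets (sum_measure M N)) (\<lambda>A. emeasure M A + emeasure N A)"
    by (simp add: positive_def)
  show "countably_additive (sets (sum_measure M N)) (\<lambda>A. emeasure M A + emeasure N A)"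
  proof (rule countably_additiveI)
    fix F :: "nat \<Rightarrow> _"
    assume F: "range F \<subseteq> sets (sum_measure M N)" "disjoint_family F"
    then have "(\<Sum>i. emeasure M (F i)) = emeasure M (\<Union>i. F i)"
      "(\<Sum>i. emeasure N (F i)) = emeasure N (\<Union>i. F i)"
      using assms(1) by (auto intro!: suminf_emeasure)
    then show "(\<Sum>i. emeasure M (F i) + emeasure N (F i)) =
        emeasure M (\<Union>i. F i) + emeasure N (\<Union>i. F i)"
      by (simp add: suminf_add[symmetric])
  qed
qed

lemma sum_measure_density:
  assumes [measurable]: "f \<in> borel_measurable M" "g \<in> borel_measurable M"
  shows "sum_measure (density M f) (density M g) = density M (\<lambda>x. f x + g x)"
proof (rule measure_eqI)
  fix A assume "A \<in> sets (sum_measure (density M f) (density M g))"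
  then have [measurable]: "A \<in> sets M" by simp
  show "emeasure (sum_measure (density M f) (density M g)) A = emeasure (density M (\<lambda>x. f x + g x)) A"
    by (simp add: emeasure_sum_measure emeasure_density distrib_right nn_integral_add)
qed simp

lemma finite_measure_sum_measure:
  assumes "finite_measure M" "finite_measure N" "sets N = sets M"
  shows "finite_measure (sum_measure M N)"
proof (rule finite_measureI)
  have "space N = space M" using assms(3) by (rule sets_eq_imp_space_eq)
  then have "emeasure N (space M) \<noteq> \<infinity>"
    using finite_measure.emeasure_finite[OF assms(2), of "space M"] by simp
  then show "emeasure (sum_measure M N) (space (sum_measure M N)) \<noteq> \<infinity>"
    using finite_measure.emeasure_finite[OF assms(1), of "space M"] assms(3)
    by (simp add: emeasure_sum_measure)
qed

lemma absolutely_continuous_sum_measure: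
  assumes "sets N = sets M"
  shows "absolutely_continuous (sum_measure M N) M" "absolutely_continuous (sum_measure M N) N"
  using assms by (auto simp: absolutely_continuous_def null_sets_def emeasure_sum_measure)

lemma homogeneous_integral_eq:
  fixes g :: "real \<Rightarrow> real \<Rightarrow> ennreal" and p q :: "'a \<Rightarrow> real"
  assumes \<mu>: "sigma_finite_measure \<mu>"
    and [measurable]: "p \<in> borel_measurable \<mu>" "q \<in> borel_measurable \<mu>"
    and nonneg: "\<forall>x\<in>space \<mu>. 0 \<le> p x" "\<forall>x\<in>space \<mu>. 0 \<le> q x"
    and P: "P = density \<mu> (\<lambda>x. ennreal (p x))" "finite_measure P"
    and Q: "Q = density \<mu> (\<lambda>x. ennreal (q x))" "finite_measure Q"
    and gm [measurable]: "(\<lambda>x. g (fst x) (snd x)) \<in> borel_measurable (borel \<Otimes>\<^sub>M borel)"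
    and hom: "\<And>h x y. 0 \<le> h \<Longrightarrow> 0 \<le> x \<Longrightarrow> 0 \<le> y \<Longrightarrow> g (h * x) (h * y) = ennreal h * g x y"
  shows "(\<integral>\<^sup>+ x. g (enn2real (RN_deriv (sum_measure P Q) P x))
                   (enn2real (RN_deriv (sum_measure P Q) Q x)) \<partial>sum_measure P Q) =
         (\<integral>\<^sup>+ x. g (p x) (q x) \<partial>\<mu>)"
proof -
  interpret sigma_finite_measure \<mu> by (rule \<mu>)
  define \<nu> where "\<nu> = sum_measure P Q"
  define h where "h = (\<lambda>x. p x + q x)"
  have [measurable]: "h \<in> borel_measurable \<mu>" by (simp add: h_def)
  have hn: "0 \<le> h x" if "x \<in> space \<mu>" for x using nonneg that by (simp add: h_def)
  have sets: "sets P = sets \<mu>" "sets Q = sets \<mu>" using P Q by simp_all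
  have \<nu>: "\<nu> = density \<mu> (\<lambda>x. ennreal (h x))"
    unfolding \<nu>_def P(1) Q(1)
    by (subst sum_measure_density) (auto simp: h_def nonneg intro!: density_cong AE_I2)
  interpret \<nu>: finite_measure \<nu>
    unfolding \<nu>_def by (rule finite_measure_sum_measure) (use P Q sets in auto)
  have key: "\<exists>r. r = (\<lambda>x. enn2real (RN_deriv \<nu> S x)) \<and> r \<in> borel_measurable \<mu> \<and> (\<forall>x. 0 \<le> r x) \<and>
      (AE x in \<mu>. s x = h x * r x)"
    if [measurable]: "s \<in> borel_measurable \<mu>" and sn: "\<forall>x\<in>space \<mu>. 0 \<le> s x"
      and S: "S = density \<mu> (\<lambda>x. ennreal (s x))" "finite_measure S" "absolutely_continuous \<nu> S"
    for s :: "'a \<Rightarrow> real" and S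
  proof (intro exI conjI)
    let ?r = "\<lambda>x. enn2real (RN_deriv \<nu> S x)"
    have "sets \<nu> = sets \<mu>" by (simp add: \<nu>)
    then have RNm [measurable]: "RN_deriv \<nu> S \<in> borel_measurable \<mu>"
      by (metis borel_measurable_RN_deriv measurable_cong_sets)
    show "?r \<in> borel_measurable \<mu>" by measurable
    have ss: "sets S = sets \<nu>" using S \<nu> by simp
    have "sigma_finite_measure S" using S(2) by (simp add: finite_measure_def)
    from \<nu>.RN_deriv_finite[OF this S(3) ss]
    have "AE x in \<nu>. RN_deriv \<nu> S x \<noteq> \<infinity>" .
    then have fin: "AE x in \<mu>. 0 < h x \<longrightarrow> RN_deriv \<nu> S x \<noteq> \<infinity>"
      by (subst (asm) (1) \<nu>) (simp add: AE_density)
    have "density \<mu> (\<lambda>x. ennreal (h x) * RN_deriv \<nu> S x) = density \<nu> (RN_deriv \<nu> S)"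
      unfolding \<nu> by (subst density_density_eq) (use RNm in \<open>auto simp: \<nu>\<close>)
    also have "\<dots> = S" by (rule \<nu>.density_RN_deriv[OF S(3) ss])
    finally have "density \<mu> (\<lambda>x. ennreal (s x)) = density \<mu> (\<lambda>x. ennreal (h x) * RN_deriv \<nu> S x)"
      using S(1) by simp
    then have "AE x in \<mu>. ennreal (s x) = ennreal (h x) * RN_deriv \<nu> S x"
      by (subst (asm) density_unique_iff) auto
    then show "AE x in \<mu>. s x = h x * ?r x"
      using fin AE_space
    proof eventually_elim
      case (elim x)
      have "s x = enn2real (ennreal (s x))" using sn elim(3) by simp
      also have "\<dots> = h x * ?r x" using elim hn[of x] by (simp add: enn2real_mult)
      finally show ?case .
    qed
  qed simp_all
  have ac: "absolutely_continuous \<nu> P" "absolutely_continuous \<nu> Q"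
    unfolding \<nu>_def using sets by (auto intro: absolutely_continuous_sum_measure)
  obtain p' where p': "p' = (\<lambda>x. enn2real (RN_deriv \<nu> P x))" "\<And>x. 0 \<le> p' x"
      "AE x in \<mu>. p x = h x * p' x" and [measurable]: "p' \<in> borel_measurable \<mu>"
    using key[OF _ nonneg(1) P ac(1)] by auto
  obtain q' where q': "q' = (\<lambda>x. enn2real (RN_deriv \<nu> Q x))" "\<And>x. 0 \<le> q' x"
      "AE x in \<mu>. q x = h x * q' x" and [measurable]: "q' \<in> borel_measurable \<mu>"
    using key[OF _ nonneg(2) Q ac(2)] by auto
  have [measurable]: "(\<lambda>x. g (p' x) (q' x)) \<in> borel_measurable \<mu>"
    using measurable_compose[OF _ gm, of "\<lambda>x. (p' x, q' x)"] by simp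
  have "(\<integral>\<^sup>+ x. g (p' x) (q' x) \<partial>\<nu>) = (\<integral>\<^sup>+ x. ennreal (h x) * g (p' x) (q' x) \<partial>\<mu>)"
    unfolding \<nu> by (subst nn_integral_density) auto
  also have "\<dots> = (\<integral>\<^sup>+ x. g (p x) (q x) \<partial>\<mu>)"
  proof (rule nn_integral_cong_AE)
    show "AE x in \<mu>. ennreal (h x) * g (p' x) (q' x) = g (p x) (q x)"
      using p'(3) q'(3) AE_space
      by eventually_elim (simp add: hom hn p'(2) q'(2))
  qed
  finally show ?thesis by (simp add: p'(1) q'(1) \<nu>_def)
qed

lemma renyi_integrand_homogeneous:
  assumes "0 \<le> h" "0 \<le> x" "0 \<le> y" "0 < a" "a \<noteq> 1"
  shows "renyi_integrand a (h * x) (h * y) = ennreal h * renyi_integrand a x y"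
proof (cases "h = 0")
  case True
  then show ?thesis by (simp add: renyi_integrand_def)
next
  case False
  with assms have h: "0 < h" by simp
  show ?thesis
  proof (cases "a < 1")
    case True
    have "h powr a * h powr (1 - a) = h" using h by (simp flip: powr_add)
    then have "(h * x) powr a * (h * y) powr (1 - a) = h * (x powr a * y powr (1 - a))"
      using assms by (simp add: powr_mult)
    then show ?thesis
      using True assms by (simp add: renyi_integrand_def ennreal_mult)
  next
    case False
    show ?thesis
    proof (cases "x = 0 \<or> y = 0")
      case True
      then show ?thesis using False assms h
        by (auto simp: renyi_integrand_def divide_ennreal_def ennreal_mult_top ennreal_top_mult ennreal_mult)
    next
      case F: False
      with assms have xy: "0 < x" "0 < y" by auto
      have "h powr a / h powr (a - 1) = h" using h by (simp flip: powr_diff)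
      then have "(h * x) powr a / (h * y) powr (a - 1) = h * (x powr a / y powr (a - 1))"
        using h xy by (simp add: powr_mult) (metis times_divide_times_eq times_divide_eq_right)
      then show ?thesis
        using False h xy by (simp add: renyi_integrand_def divide_ennreal flip: ennreal_mult)
    qed
  qed
qed

lemma measurable_renyi_integrand [measurable]:
  "(\<lambda>x. renyi_integrand a (fst x) (snd x)) \<in> borel_measurable (borel \<Otimes>\<^sub>M borel)"
  unfolding renyi_integrand_def by measurable

lemma measurable_kl_integrand [measurable]:
  "(\<lambda>x. kl_integrand (fst x) (snd x)) \<in> borel_measurable (borel \<Otimes>\<^sub>M borel)"
  unfolding kl_integrand_def by measurable

lemma kl_integrand_homogeneous:
  assumes "0 \<le> h" "0 \<le> x" "0 \<le> y"
  shows "kl_integrand (h * x) (h * y) = ereal h * kl_integrand x y"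
  using assms by (auto simp: kl_integrand_def)

lemma e2ennreal_mult_left:
  assumes "0 \<le> h"
  shows "e2ennreal (ereal h * z) = ennreal h * e2ennreal z"
proof (cases "0 \<le> z")
  case True
  then show ?thesis using assms
    by (metis e2ennreal_ereal ennreal.rep_eq enn2ereal_e2ennreal enn2ereal_ennreal e2ennreal_enn2ereal times_ennreal.rep_eq)
next
  case False
  then have "z \<le> 0" by simp
  moreover have "ereal h * z \<le> 0"
    using assms \<open>z \<le> 0\<close> by (simp add: ereal_mult_le_0_iff)
  ultimately show ?thesis by (simp add: e2ennreal_neg)
qed

lemma renyi_divergence_eq:
  fixes p q :: "'a \<Rightarrow> real"
  assumes "sigma_finite_measure \<mu>" "p \<in> borel_measurable \<mu>" "q \<in> borel_measurable \<mu>"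
    and "\<forall>x\<in>space \<mu>. 0 \<le> p x" "\<forall>x\<in>space \<mu>. 0 \<le> q x"
    and "P = density \<mu> (\<lambda>x. ennreal (p x))" "finite_measure P"
    and "Q = density \<mu> (\<lambda>x. ennreal (q x))" "finite_measure Q"
    and "0 < a" "a \<noteq> 1"
  shows "renyi_divergence a P Q = ereal (1 / (a - 1)) * ln_ennreal (renyi_integral \<mu> a p q)"
  unfolding renyi_divergence_def Let_def renyi_integral_def
  by (subst homogeneous_integral_eq[OF assms(1-9)])
     (use assms in \<open>auto simp: renyi_integrand_homogeneous\<close>)

lemma kl_divergence_eq:
  fixes p q :: "'a \<Rightarrow> real"
  assumes "sigma_finite_measure \<mu>" "p \<in> borel_measurable \<mu>" "q \<in> borel_measurable \<mu>"
    and "\<forall>x\<in>space \<mu>. 0 \<le> p x" "\<forall>x\<in>space \<mu>. 0 \<le> q x"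
    and "P = density \<mu> (\<lambda>x. ennreal (p x))" "finite_measure P"
    and "Q = density \<mu> (\<lambda>x. ennreal (q x))" "finite_measure Q"
  shows "kl_divergence P Q = kl_integral \<mu> p q"
proof -
  have 1: "e2ennreal (kl_integrand (h * x) (h * y)) = ennreal h * e2ennreal (kl_integrand x y)"
    "e2ennreal (- kl_integrand (h * x) (h * y)) = ennreal h * e2ennreal (- kl_integrand x y)"
    if "0 \<le> h" "0 \<le> x" "0 \<le> y" for h x y
    using that by (simp_all add: kl_integrand_homogeneous e2ennreal_mult_left flip: ereal_mult_minus_right)
  have 2: "(\<lambda>x. e2ennreal (kl_integrand (fst x) (snd x))) \<in> borel_measurable (borel \<Otimes>\<^sub>M borel)"
    "(\<lambda>x. e2ennreal (- kl_integrand (fst x) (snd x))) \<in> borel_measurable (borel \<Otimes>\<^sub>M borel)"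
    by measurable
  show ?thesis
    unfolding kl_divergence_def Let_def kl_integral_def
    using homogeneous_integral_eq[OF assms, of "\<lambda>x y. e2ennreal (kl_integrand x y)", OF 2(1) 1(1)]
      homogeneous_integral_eq[OF assms, of "\<lambda>x y. e2ennreal (- kl_integrand x y)", OF 2(2) 1(2)]
    by simp
qed

end

theory Submission
  imports Defs
begin

text \<open>Put \<open>w = p\<^sup>\<alpha> q\<^sup>1\<^sup>-\<^sup>\<alpha>\<close> and \<open>Z = \<integral> w d\<mu>\<close>. If \<open>0 < Z < \<infinity>\<close>, \<open>R\<close> has density \<open>r\<close>
  and its mixture is not \<open>\<infinity>\<close>, the mixture equals \<open>\<integral> r ln (r / w) d\<mu> = D(R \<parallel> P\<^sub>\<alpha>) - ln Z\<close>, and Gibbs'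
  inequality gives the lower bound \<open>- ln Z\<close>, attained only at \<open>P\<^sub>\<alpha>\<close>. For the upper bound \<open>P\<^sub>\<alpha>\<close> need
  not exist or may have infinite divergence from \<open>P\<close>, so \<open>w\<close> is first restricted to the set where
  \<open>p \<le> n q\<close> and \<open>q \<le> n p\<close>: after normalization both divergences are finite, the mixture is
  \<open>- ln Z\<^sub>n\<close>, and \<open>Z\<^sub>n\<close> increases to \<open>Z\<close>. This misses the mass of \<open>P\<close> on \<open>{q = 0}\<close>; if \<open>\<alpha> > 1\<close> and
  that mass is positive, then \<open>Z = \<infinity>\<close>, and \<open>R = P\<close> already gives \<open>- \<infinity>\<close>.\<close>

section \<open>Pointwise Gibbs inequality and its equality case\<close>

lemma diff_le_mult_ln:
  fixes r s :: real
  assumes "0 \<le> r" "0 \<le> s" "s = 0 \<longrightarrow> r = 0"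
  shows "r - s \<le> r * ln (r / s)"
proof (cases "r = 0")
  case False
  with assms have "0 < r" "0 < s" by auto
  \<comment> \<open>This is \<open>ln t \<le> t - 1\<close> at \<open>t = s / r\<close>, scaled by
    \<open>r\<close>.\<close>
  then have "r * ln (s / r) \<le> r * (s / r - 1)"
    by (intro mult_left_mono ln_le_minus_one) auto
  then show ?thesis
    using \<open>0 < r\<close> \<open>0 < s\<close> by (simp add: ln_div right_diff_distrib)
qed (use assms in auto)

text \<open>For positive \<open>t\<close>, \<open>ln t = t - 1\<close> only at \<open>t = 1\<close>.
  This strictness is what later makes the minimizer unique.\<close>

lemma mult_ln_eq_diff_iff:
  fixes r s :: real
  assumes "0 \<le> r" "0 \<le> s" "s = 0 \<longrightarrow> r = 0"
  shows "r * ln (r / s) = r - s \<longleftrightarrow> r = s"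
proof
  assume eq: "r * ln (r / s) = r - s"
  show "r = s"
  proof (cases "r = 0")
    case False
    with assms have pos: "0 < r" "0 < s" by auto
    with eq have "r * ln (s / r) = r * (s / r - 1)"
      by (simp add: ln_div right_diff_distrib)
    with pos have "ln (s / r) = s / r - 1" by simp
    with pos have "s / r = 1" by (intro ln_eq_minus_one) auto
    with pos show ?thesis by simp
  qed (use eq assms in auto)
qed (use assms in auto)

text \<open>Mainly for integrands \<open>r * ln (r / s)\<close>: Gibbs' inequality supplies an
  integrable lower bound, and upper bounds come from trading one divergence against the
  other.\<close>

lemma integrable_sandwich:
  fixes f l u :: "'a \<Rightarrow> real"
  assumes [measurable]: "integrable M l" "integrable M u" "f \<in> borel_measurable M"
    and "AE x in M. l x \<le> f x" "AE x in M. f x \<le> u x"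
  shows "integrable M f"
proof (rule Bochner_Integration.integrable_bound[where f = "\<lambda>x. \<bar>l x\<bar> + \<bar>u x\<bar>"])
  show "AE x in M. norm (f x) \<le> norm (\<bar>l x\<bar> + \<bar>u x\<bar>)"
    using assms(4,5) by eventually_elim auto
qed (use assms in auto)

section \<open>The divergence integral and its negative part\<close>

lemma e2ennreal_minus_kl_integrand_le:
  assumes "0 \<le> r" "0 \<le> s"
  shows "e2ennreal (- kl_integrand r s) \<le> ennreal s"
proof (cases "r = 0 \<or> s = 0")
  case False
  with assms have "- (r * ln (r / s)) \<le> s"
    using diff_le_mult_ln[of r s] by auto
  with False show ?thesis by (simp add: kl_integrand_def e2ennreal_ereal ennreal_leI)
qed (auto simp: kl_integrand_def e2ennreal_neg)

lemma kl_integrand_measurable: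
  fixes r s :: "'a \<Rightarrow> real"
  assumes [measurable]: "r \<in> borel_measurable M" "s \<in> borel_measurable M"
  shows "(\<lambda>x. kl_integrand (r x) (s x)) \<in> borel_measurable M"
  using measurable_compose[OF _ measurable_kl_integrand, of "\<lambda>x. (r x, s x)"] by simp

text \<open>The negative part lies below \<open>s\<close>, because
  \<open>r * ln (r / s) \<ge> r - s \<ge> - s\<close>. So the subtracted term of
  \<open>kl_integral\<close> is finite and the difference is never
  \<open>\<infinity> - \<infinity>\<close>.\<close>

lemma nn_integral_minus_kl_integrand_finite:
  fixes r s :: "'a \<Rightarrow> real"
  assumes "integrable M s" "\<And>x. x \<in> space M \<Longrightarrow> 0 \<le> r x" "\<And>x. x \<in> space M \<Longrightarrow> 0 \<le> s x"
  shows "(\<integral>\<^sup>+ x. e2ennreal (- kl_integrand (r x) (s x)) \<partial>M) < \<infinity>"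
proof -
  have "(\<integral>\<^sup>+ x. e2ennreal (- kl_integrand (r x) (s x)) \<partial>M) \<le> (\<integral>\<^sup>+ x. ennreal (s x) \<partial>M)"
    using assms by (intro nn_integral_mono e2ennreal_minus_kl_integrand_le) auto
  also have "\<dots> < \<infinity>"
    using assms by (subst nn_integral_eq_integral) (auto intro: AE_I2)
  finally show ?thesis .
qed

lemma kl_integral_ne_MInf:
  assumes "integrable M s" "\<And>x. x \<in> space M \<Longrightarrow> 0 \<le> r x" "\<And>x. x \<in> space M \<Longrightarrow> 0 \<le> s x"
  shows "kl_integral M r s \<noteq> - \<infinity>"
proof -
  define a where "a = (\<integral>\<^sup>+ x. e2ennreal (kl_integrand (r x) (s x)) \<partial>M)"
  define b where "b = (\<integral>\<^sup>+ x. e2ennreal (- kl_integrand (r x) (s x)) \<partial>M)"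
  have "b < \<infinity>"
    unfolding b_def using nn_integral_minus_kl_integrand_finite[OF assms] .
  then have "enn2ereal a - enn2ereal b \<noteq> - \<infinity>"
    by (cases a; cases b) (auto simp: enn2ereal_ennreal)
  then show ?thesis by (simp add: kl_integral_def a_def b_def)
qed

text \<open>As the negative part has finite integral, a value other than \<open>\<infinity>\<close>
  makes the integral of the positive part finite too. The integrand is then finite almost
  everywhere, which excludes \<open>s = 0 < r\<close> up to a null set and leaves the real
  expression.\<close>

lemma kl_integral_finiteD:
  fixes r s :: "'a \<Rightarrow> real"
  assumes [measurable]: "r \<in> borel_measurable M" and s: "integrable M s"
    and nonneg: "\<And>x. x \<in> space M \<Longrightarrow> 0 \<le> r x" "\<And>x. x \<in> space M \<Longrightarrow> 0 \<le> s x"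
    and fin: "kl_integral M r s \<noteq> \<infinity>"
  shows "AE x in M. s x = 0 \<longrightarrow> r x = 0" "integrable M (\<lambda>x. r x * ln (r x / s x))"
proof -
  have [measurable]: "s \<in> borel_measurable M" using s by simp
  note [measurable] = kl_integrand_measurable[of r M s]
  define a where "a = (\<integral>\<^sup>+ x. e2ennreal (kl_integrand (r x) (s x)) \<partial>M)"
  define b where "b = (\<integral>\<^sup>+ x. e2ennreal (- kl_integrand (r x) (s x)) \<partial>M)"
  have b: "b < \<infinity>"
    unfolding b_def using nn_integral_minus_kl_integrand_finite[OF s nonneg] .
  have "enn2ereal a - enn2ereal b \<noteq> \<infinity>"
    using fin by (simp add: kl_integral_def a_def b_def)
  with b have a: "a \<noteq> \<infinity>"
    by (cases a; cases b) (auto simp: enn2ereal_ennreal)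
  then have "AE x in M. e2ennreal (kl_integrand (r x) (s x)) \<noteq> \<infinity>"
    unfolding a_def by (intro nn_integral_PInf_AE) auto
  then show ac: "AE x in M. s x = 0 \<longrightarrow> r x = 0"
    by eventually_elim (auto simp: kl_integrand_def split: if_splits)
  have "(\<integral>\<^sup>+ x. ennreal (r x * ln (r x / s x)) \<partial>M) = a"
    unfolding a_def by (rule nn_integral_cong_AE, use ac in eventually_elim)
      (auto simp: kl_integrand_def e2ennreal_ereal)
  moreover have "(\<integral>\<^sup>+ x. ennreal (- (r x * ln (r x / s x))) \<partial>M) = b"
    unfolding b_def by (rule nn_integral_cong_AE, use ac in eventually_elim)
      (auto simp: kl_integrand_def e2ennreal_ereal)
  ultimately show "integrable M (\<lambda>x. r x * ln (r x / s x))"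
    using a b by (simp add: real_integrable_def)
qed

lemma kl_integral_eq_integral:
  fixes r s :: "'a \<Rightarrow> real"
  assumes ac: "AE x in M. s x = 0 \<longrightarrow> r x = 0"
    and int: "integrable M (\<lambda>x. r x * ln (r x / s x))"
  shows "kl_integral M r s = ereal (\<integral>x. r x * ln (r x / s x) \<partial>M)"
proof -
  let ?f = "\<lambda>x. r x * ln (r x / s x)"
  have 1: "(\<integral>\<^sup>+ x. e2ennreal (kl_integrand (r x) (s x)) \<partial>M) = (\<integral>\<^sup>+ x. ennreal (?f x) \<partial>M)"
    by (rule nn_integral_cong_AE, use ac in eventually_elim)
      (auto simp: kl_integrand_def e2ennreal_ereal)
  have 2: "(\<integral>\<^sup>+ x. e2ennreal (- kl_integrand (r x) (s x)) \<partial>M) = (\<integral>\<^sup>+ x. ennreal (- ?f x) \<partial>M)"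
    by (rule nn_integral_cong_AE, use ac in eventually_elim)
      (auto simp: kl_integrand_def e2ennreal_ereal)
  obtain a where a: "(\<integral>\<^sup>+ x. ennreal (?f x) \<partial>M) = ennreal a" "0 \<le> a"
    using int by (cases "\<integral>\<^sup>+ x. ennreal (?f x) \<partial>M") (auto simp: real_integrable_def)
  obtain b where b: "(\<integral>\<^sup>+ x. ennreal (- ?f x) \<partial>M) = ennreal b" "0 \<le> b"
    using int by (cases "\<integral>\<^sup>+ x. ennreal (- ?f x) \<partial>M") (auto simp: real_integrable_def)
  show ?thesis
    unfolding kl_integral_def 1 2 real_lebesgue_integral_def[OF int]
    using a b by (simp add: enn2ereal_ennreal)
qed

section \<open>Densities for arbitrary pairs of distributions\<close>

lemma real_densityE:
  assumes "sigma_finite_measure M" "finite_measure N" "absolutely_continuous M N" "sets N = sets M"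
  obtains f :: "'a \<Rightarrow> real" where "f \<in> borel_measurable M" "\<And>x. 0 \<le> f x"
    "N = density M (\<lambda>x. ennreal (f x))"
proof -
  interpret sigma_finite_measure M by fact
  obtain f :: "'a \<Rightarrow> real" where f: "f \<in> borel_measurable M"
    "AE x in M. RN_deriv M N x = ennreal (f x)" "\<And>x. 0 \<le> f x"
    using real_RN_deriv[OF assms(2-4)] by metis
  have "N = density M (RN_deriv M N)"
    using density_RN_deriv[OF assms(3,4)] by simp
  also have "\<dots> = density M (\<lambda>x. ennreal (f x))"
    using f by (intro density_cong) auto
  finally show thesis using that f by blast
qed

lemma integrable_density_finite:
  fixes f :: "'a \<Rightarrow> real"
  assumes [measurable]: "f \<in> borel_measurable M" and "\<And>x. x \<in> space M \<Longrightarrow> 0 \<le> f x"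
    and "finite_measure (density M (\<lambda>x. ennreal (f x)))"
  shows "integrable M f"
proof -
  interpret N: finite_measure "density M (\<lambda>x. ennreal (f x))" by fact
  have "(\<integral>\<^sup>+ x. ennreal (f x) \<partial>M) = emeasure (density M (\<lambda>x. ennreal (f x))) (space M)"
    by (auto simp: emeasure_density cong: nn_integral_cong)
  also have "\<dots> < \<infinity>" by (metis N.emeasure_finite less_top infinity_ennreal_def)
  finally show ?thesis using assms by (intro integrableI_nonneg) (auto intro: AE_I2)
qed

text \<open>A competing distribution need not be dominated by the measure chosen for
  \<open>P\<close> and \<open>Q\<close>. Its divergence from \<open>P\<close> is therefore first
  studied under \<open>sum_measure R P\<close>, which dominates both.\<close>

lemma kl_divergence_sum_measureE:
  assumes "prob_space R" "prob_space P" "sets R = sets P"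
  obtains M :: "'a measure" and r s :: "'a \<Rightarrow> real" where
    "r \<in> borel_measurable M" "integrable M s" "\<And>x. 0 \<le> r x" "\<And>x. 0 \<le> s x"
    "R = density M (\<lambda>x. ennreal (r x))" "P = density M (\<lambda>x. ennreal (s x))"
    "kl_divergence R P = kl_integral M r s"
proof -
  define M where "M = sum_measure R P"
  have fin: "finite_measure R" "finite_measure P"
    using assms by (auto simp: prob_space_def)
  then have "finite_measure M"
    unfolding M_def using assms by (intro finite_measure_sum_measure) auto
  then have M: "sigma_finite_measure M" by (simp add: finite_measure_def)
  have ac: "absolutely_continuous M R" "absolutely_continuous M P"
    unfolding M_def using assms by (auto intro: absolutely_continuous_sum_measure)
  have sets: "sets R = sets M" "sets P = sets M"
    using assms by (simp_all add: M_def)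
  obtain r where r: "r \<in> borel_measurable M" "\<And>x. 0 \<le> r x" "R = density M (\<lambda>x. ennreal (r x))"
    using real_densityE[OF M fin(1) ac(1) sets(1)] by metis
  obtain s where s: "s \<in> borel_measurable M" "\<And>x. 0 \<le> s x" "P = density M (\<lambda>x. ennreal (s x))"
    using real_densityE[OF M fin(2) ac(2) sets(2)] by metis
  have int: "integrable M s"
    using s(1,2) fin(2) unfolding s(3) by (intro integrable_density_finite)
  have kl: "kl_divergence R P = kl_integral M r s"
    using r(2) s(2) by (intro kl_divergence_eq[OF M r(1) s(1) _ _ r(3) fin(1) s(3) fin(2)]) auto
  show thesis
    by (rule that[OF r(1) int r(2) s(2) r(3) s(3) kl])
qed

lemma kl_divergence_ne_MInf:
  fixes R P :: "'a measure"
  assumes "prob_space R" "prob_space P" "sets R = sets P"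
  shows "kl_divergence R P \<noteq> - \<infinity>"
proof -
  obtain M :: "'a measure" and r s where "integrable M s" "\<And>x. 0 \<le> r x" "\<And>x. 0 \<le> s x"
    "kl_divergence R P = kl_integral M r s"
    using kl_divergence_sum_measureE[OF assms] by metis
  then show ?thesis using kl_integral_ne_MInf[of M s r] by simp
qed

text \<open>Through this fact a competitor acquires a density with respect to \<open>\<mu>\<close>:
  it is dominated by \<open>P\<close>, and \<open>P\<close> by \<open>\<mu>\<close>.\<close>

lemma kl_divergence_finite_imp_absolutely_continuous:
  fixes R P :: "'a measure"
  assumes "prob_space R" "prob_space P" "sets R = sets P" "kl_divergence R P \<noteq> \<infinity>"
  shows "absolutely_continuous P R"
proof -
  obtain M :: "'a measure" and r s where *: "r \<in> borel_measurable M" "integrable M s" "\<And>x. 0 \<le> r x" "\<And>x. 0 \<le> s x"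
    "R = density M (\<lambda>x. ennreal (r x))" "P = density M (\<lambda>x. ennreal (s x))"
    "kl_divergence R P = kl_integral M r s"
    using kl_divergence_sum_measureE[OF assms(1-3)] by metis
  have ac: "AE x in M. s x = 0 \<longrightarrow> r x = 0"
    using kl_integral_finiteD(1)[of r M s] * assms(4) by auto
  show ?thesis
    unfolding absolutely_continuous_def
  proof
    fix A assume "A \<in> null_sets P"
    then have "A \<in> sets M" "AE x in M. x \<in> A \<longrightarrow> s x = 0"
      using * by (auto simp: null_sets_density_iff ennreal_eq_0_iff intro: order_antisym)
    moreover have "AE x in M. x \<in> A \<longrightarrow> r x = 0"
      using calculation(2) ac by eventually_elim auto
    ultimately show "A \<in> null_sets R"
      using * by (auto simp: null_sets_density_iff)
  qed
qed

section \<open>Infinite values of the mixture and of the logarithm\<close>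

lemma kl_mixture_eq_top:
  assumes "0 < \<alpha>" "\<alpha> \<noteq> 1" "kl_divergence R Q \<noteq> - \<infinity>" "kl_divergence R P = \<infinity>"
  shows "kl_mixture \<alpha> P Q R = \<infinity>"
  \<comment> \<open>If \<open>\<alpha> > 1\<close> and both divergences are
    \<open>\<infinity>\<close>, the terms are \<open>\<infinity>\<close> and
    \<open>- \<infinity>\<close>, and the convention in \<open>kl_mixture\<close> decides. Otherwise
    the second term is not \<open>- \<infinity>\<close>.\<close>
  using assms by (cases "kl_divergence R Q") (auto simp: kl_mixture_def Let_def)

text \<open>The \<open>case\<close> expression is the exponential extended to \<open>ereal\<close>,
  so logarithm and exponential form a Galois connection. Bounds on logarithms then pass to suprema
  with no continuity argument.\<close>

lemma ln_ennreal_le_iff: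
  "ln_ennreal z \<le> c \<longleftrightarrow> z \<le> (case c of ereal t \<Rightarrow> ennreal (exp t) | PInfty \<Rightarrow> \<infinity> | MInfty \<Rightarrow> 0)"
proof (cases "z = 0 \<or> z = \<infinity>")
  case True
  then show ?thesis
    by (cases c) (auto simp: ln_ennreal_def top_unique)
next
  case False
  then obtain t where t: "z = ennreal t" "0 < t"
    by (cases z) (auto simp: less_le)
  have "ln t \<le> u \<longleftrightarrow> t \<le> exp u" for u
    using t(2) by (metis exp_le_cancel_iff exp_ln)
  then show ?thesis using t
    by (cases c) (auto simp: ln_ennreal_def ennreal_eq_0_iff)
qed

lemma ln_ennreal_SUP_le:
  assumes "\<And>n. ln_ennreal (f n) \<le> c"
  shows "ln_ennreal (SUP n. f n) \<le> c"
  using assms unfolding ln_ennreal_le_iff by (rule SUP_least)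

section \<open>Fixed densities and the unnormalized tilted density\<close>

locale renyi_pair = sigma_finite_measure \<mu>
  for \<mu> :: "'a measure" +
  fixes P Q :: "'a measure" and p q :: "'a \<Rightarrow> real" and \<alpha> :: real
  assumes p_measurable [measurable]: "p \<in> borel_measurable \<mu>"
    and p_nonneg: "\<And>x. x \<in> space \<mu> \<Longrightarrow> 0 \<le> p x"
    and q_measurable [measurable]: "q \<in> borel_measurable \<mu>"
    and q_nonneg: "\<And>x. x \<in> space \<mu> \<Longrightarrow> 0 \<le> q x"
    and prob_P: "prob_space P" and P_eq: "P = density \<mu> (\<lambda>x. ennreal (p x))"
    and prob_Q: "prob_space Q" and Q_eq: "Q = density \<mu> (\<lambda>x. ennreal (q x))"
    and order_pos: "0 < \<alpha>" and order_ne_1: "\<alpha> \<noteq> 1"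
begin

text \<open>A real-valued stand-in for \<open>renyi_integrand\<close>. The two differ only for
  \<open>\<alpha> > 1\<close> at points with \<open>q x = 0 < p x\<close>: there
  \<open>w x = 0\<close>, since \<open>powr\<close> with base 0 is 0, while
  \<open>renyi_integrand\<close> is \<open>\<infinity>\<close>.\<close>

definition w :: "'a \<Rightarrow> real" where
  "w x = p x powr \<alpha> * q x powr (1 - \<alpha>)"

abbreviation Z :: ennreal where
  "Z \<equiv> renyi_integral \<mu> \<alpha> p q"

text \<open>For \<open>\<alpha> > 1\<close> this says \<open>P \<lless> Q\<close>; it rules out the points where
  \<^const>\<open>renyi_integrand\<close> is \<open>\<infinity>\<close>.\<close>
definition regular :: bool where
  "regular \<longleftrightarrow> \<alpha> < 1 \<or> (AE x in \<mu>. q x = 0 \<longrightarrow> p x = 0)"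

lemma sets_P [simp]: "sets P = sets \<mu>" and sets_Q [simp]: "sets Q = sets \<mu>"
  by (simp_all add: P_eq Q_eq)

lemma integrable_p: "integrable \<mu> p" and integrable_q: "integrable \<mu> q"
  using prob_P prob_Q p_nonneg q_nonneg unfolding P_eq Q_eq prob_space_def
  by (auto intro!: integrable_density_finite)

lemma w_measurable [measurable]: "w \<in> borel_measurable \<mu>"
  unfolding w_def by measurable

lemma w_nonneg: "0 \<le> w x"
  by (simp add: w_def)

lemma w_eq_0_iff: "w x = 0 \<longleftrightarrow> p x = 0 \<or> q x = 0"
  by (simp add: w_def)

lemma ln_w:
  assumes "0 < p x" "0 < q x"
  shows "ln (w x) = \<alpha> * ln (p x) + (1 - \<alpha>) * ln (q x)"
  using assms by (simp add: w_def ln_mult ln_powr)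

lemma renyi_integrand_eq_w:
  assumes "x \<in> space \<mu>" "\<alpha> < 1 \<or> (q x = 0 \<longrightarrow> p x = 0)"
  shows "renyi_integrand \<alpha> (p x) (q x) = ennreal (w x)"
proof (cases "\<alpha> < 1")
  case True
  then show ?thesis by (simp add: renyi_integrand_def w_def)
next
  case False
  show ?thesis
  proof (cases "q x = 0")
    case True
    with False assms show ?thesis by (simp add: renyi_integrand_def w_def)
  next
    case F: False
    with q_nonneg[OF assms(1)] have "0 < q x" by simp
    then have "p x powr \<alpha> / q x powr (\<alpha> - 1) = w x"
      by (simp add: w_def powr_diff field_simps)
    with \<open>0 < q x\<close> False show ?thesis
      by (simp add: renyi_integrand_def divide_ennreal)
  qed
qed

lemma AE_renyi_integrand:
  assumes regular
  shows "AE x in \<mu>. renyi_integrand \<alpha> (p x) (q x) = ennreal (w x)"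
proof -
  have "AE x in \<mu>. \<alpha> < 1 \<or> (q x = 0 \<longrightarrow> p x = 0)"
    using assms unfolding regular_def by auto
  with AE_space show ?thesis
    by eventually_elim (auto intro: renyi_integrand_eq_w)
qed

lemma Z_eq:
  assumes regular
  shows "Z = (\<integral>\<^sup>+ x. ennreal (w x) \<partial>\<mu>)"
  unfolding renyi_integral_def using AE_renyi_integrand[OF assms] by (rule nn_integral_cong_AE)

lemma renyi_integrand_measurable [measurable]:
  "(\<lambda>x. renyi_integrand \<alpha> (p x) (q x)) \<in> borel_measurable \<mu>"
  using measurable_compose[OF _ measurable_renyi_integrand, of "\<lambda>x. (p x, q x)"] by simp

text \<open>A finite integral has an almost everywhere finite integrand, and for
  \<open>\<alpha> > 1\<close> a positive numerator over 0 is \<open>\<infinity>\<close>. It is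
  mostly used in contrapositive form: finite \<open>Z\<close> gives \<open>regular\<close>.\<close>

lemma Z_eq_top:
  assumes "\<not> regular"
  shows "Z = \<infinity>"
proof (rule ccontr)
  assume "Z \<noteq> \<infinity>"
  then have "AE x in \<mu>. renyi_integrand \<alpha> (p x) (q x) \<noteq> \<infinity>"
    unfolding renyi_integral_def by (intro nn_integral_PInf_AE) auto
  then have "\<not> \<alpha> < 1 \<longrightarrow> (AE x in \<mu>. q x = 0 \<longrightarrow> p x = 0)"
    using AE_space
    by (intro impI, eventually_elim)
      (auto simp: renyi_integrand_def order_pos order_ne_1 divide_ennreal_def ennreal_mult_top split: if_splits)
  with assms show False by (auto simp: regular_def)
qed

lemma integrable_w:
  assumes "Z < \<infinity>"
  shows "integrable \<mu> w" "Z = ennreal (\<integral>x. w x \<partial>\<mu>)"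
proof -
  have Z: "Z = (\<integral>\<^sup>+ x. ennreal (w x) \<partial>\<mu>)"
    using Z_eq Z_eq_top assms by (metis less_irrefl)
  with assms show w: "integrable \<mu> w"
    by (intro integrableI_nonneg) (auto simp: w_nonneg)
  show "Z = ennreal (\<integral>x. w x \<partial>\<mu>)"
    unfolding Z using w by (intro nn_integral_eq_integral) (auto simp: w_nonneg)
qed

section \<open>The mixture as a single integral\<close>

lemma kl_divergence_density:
  fixes r :: "'a \<Rightarrow> real"
  assumes "r \<in> borel_measurable \<mu>" "\<And>x. x \<in> space \<mu> \<Longrightarrow> 0 \<le> r x"
    and "prob_space (density \<mu> (\<lambda>x. ennreal (r x)))"
  shows "kl_divergence (density \<mu> (\<lambda>x. ennreal (r x))) P = kl_integral \<mu> r p"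
    and "kl_divergence (density \<mu> (\<lambda>x. ennreal (r x))) Q = kl_integral \<mu> r q"
  using assms p_nonneg q_nonneg prob_P prob_Q
  by (auto simp: prob_space_def intro!: kl_divergence_eq sigma_finite_measure_axioms P_eq Q_eq)

text \<open>The coefficients sum to 1, so \<open>ln r\<close> survives once and the logarithms of
  \<open>p\<close> and \<open>q\<close> combine to \<open>ln w\<close>.\<close>

lemma mixed_kl_integrand:
  assumes "x \<in> space \<mu>" "0 \<le> r" "p x = 0 \<longrightarrow> r = 0" "q x = 0 \<longrightarrow> r = 0"
  shows "\<alpha> * (r * ln (r / p x)) + (1 - \<alpha>) * (r * ln (r / q x)) = r * ln (r / w x)"
proof (cases "r = 0")
  case False
  with assms p_nonneg[of x] q_nonneg[of x] have *: "0 < r" "0 < p x" "0 < q x"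
    by auto
  moreover have "0 < w x"
    using * w_nonneg[of x] w_eq_0_iff[of x] by auto
  ultimately show ?thesis
    by (simp add: ln_div ln_w algebra_simps)
qed simp

text \<open>Both divergences are finite here, so the convention for undefined sums is not triggered
  and the integrals combine linearly.\<close>

lemma kl_mixture_density:
  fixes r :: "'a \<Rightarrow> real"
  assumes "r \<in> borel_measurable \<mu>" "\<And>x. x \<in> space \<mu> \<Longrightarrow> 0 \<le> r x"
    and "prob_space (density \<mu> (\<lambda>x. ennreal (r x)))"
    and ac: "AE x in \<mu>. p x = 0 \<longrightarrow> r x = 0" "AE x in \<mu>. q x = 0 \<longrightarrow> r x = 0"
    and int: "integrable \<mu> (\<lambda>x. r x * ln (r x / p x))" "integrable \<mu> (\<lambda>x. r x * ln (r x / q x))"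
  shows "integrable \<mu> (\<lambda>x. r x * ln (r x / w x))"
    and "kl_mixture \<alpha> P Q (density \<mu> (\<lambda>x. ennreal (r x))) = ereal (\<integral>x. r x * ln (r x / w x) \<partial>\<mu>)"
proof -
  have [measurable]: "r \<in> borel_measurable \<mu>" by fact
  let ?h = "\<lambda>x. \<alpha> * (r x * ln (r x / p x)) + (1 - \<alpha>) * (r x * ln (r x / q x))"
  have eq: "AE x in \<mu>. ?h x = r x * ln (r x / w x)"
    using ac AE_space by eventually_elim (auto intro: mixed_kl_integrand assms)
  have "integrable \<mu> ?h" using int by simp
  then show "integrable \<mu> (\<lambda>x. r x * ln (r x / w x))"
    by (rule integrable_cong_AE_imp) (use eq in auto)
  have "kl_mixture \<alpha> P Q (density \<mu> (\<lambda>x. ennreal (r x))) = ereal (\<integral>x. ?h x \<partial>\<mu>)"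
    using int by (simp add: kl_mixture_def kl_divergence_density[OF assms(1-3)]
        kl_integral_eq_integral ac)
  also have "(\<integral>x. ?h x \<partial>\<mu>) = (\<integral>x. r x * ln (r x / w x) \<partial>\<mu>)"
    using eq by (intro integral_cong_AE) auto
  finally show "kl_mixture \<alpha> P Q (density \<mu> (\<lambda>x. ennreal (r x))) = ereal (\<integral>x. r x * ln (r x / w x) \<partial>\<mu>)" .
qed

text \<open>The upper bound on \<open>r ln (r / q)\<close> comes from
  \<open>(\<alpha> - 1) r ln (r / q) = \<alpha> r ln (r / p) - r ln (r / w)\<close> and \<open>r ln (r / w) \<ge> r - w\<close>.\<close>
lemma integrable_kl_Q:
  fixes r :: "'a \<Rightarrow> real"
  assumes "1 < \<alpha>" "Z < \<infinity>" and r: "integrable \<mu> r" "\<And>x. x \<in> space \<mu> \<Longrightarrow> 0 \<le> r x"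
    and ac: "AE x in \<mu>. p x = 0 \<longrightarrow> r x = 0" "AE x in \<mu>. q x = 0 \<longrightarrow> r x = 0"
    and int: "integrable \<mu> (\<lambda>x. r x * ln (r x / p x))"
  shows "integrable \<mu> (\<lambda>x. r x * ln (r x / q x))"
proof (rule integrable_sandwich)
  have [measurable]: "r \<in> borel_measurable \<mu>" using r by simp
  show "integrable \<mu> (\<lambda>x. r x - q x)" using r integrable_q by simp
  show "integrable \<mu> (\<lambda>x. (\<alpha> * (r x * ln (r x / p x)) - r x + w x) / (\<alpha> - 1))"
    using r int integrable_w[OF assms(2)] by simp
  show "AE x in \<mu>. r x - q x \<le> r x * ln (r x / q x)"
    using ac AE_space by eventually_elim (auto intro: diff_le_mult_ln r q_nonneg)
  show "AE x in \<mu>. r x * ln (r x / q x) \<le> (\<alpha> * (r x * ln (r x / p x)) - r x + w x) / (\<alpha> - 1)"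
    using ac AE_space
  proof eventually_elim
    case (elim x)
    have "r x - w x \<le> r x * ln (r x / w x)"
      using elim by (intro diff_le_mult_ln r w_nonneg) (auto simp: w_eq_0_iff)
    also have "\<dots> = \<alpha> * (r x * ln (r x / p x)) + (1 - \<alpha>) * (r x * ln (r x / q x))"
      using elim by (intro mixed_kl_integrand[symmetric] r) auto
    finally show ?case
      using assms(1) by (simp add: pos_le_divide_eq algebra_simps)
  qed
qed (use r in auto)

text \<open>Finiteness of the divergence from \<open>P\<close> gives the density \<open>r\<close>.
  For \<open>\<alpha> < 1\<close> an infinite divergence from \<open>Q\<close> would make the
  mixture \<open>\<infinity>\<close>. For \<open>\<alpha> > 1\<close> its coefficient is negative,
  so finiteness of \<open>Z\<close> is used instead, through \<open>regular\<close> and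
  \<open>integrable_kl_Q\<close>.\<close>

lemma kl_mixture_finiteE:
  assumes R: "prob_space R" "sets R = sets \<mu>" and fin: "kl_mixture \<alpha> P Q R \<noteq> \<infinity>" "Z < \<infinity>"
  obtains r :: "'a \<Rightarrow> real" where "r \<in> borel_measurable \<mu>" "\<And>x. 0 \<le> r x"
    "R = density \<mu> (\<lambda>x. ennreal (r x))"
    "AE x in \<mu>. p x = 0 \<longrightarrow> r x = 0" "AE x in \<mu>. q x = 0 \<longrightarrow> r x = 0"
    "integrable \<mu> (\<lambda>x. r x * ln (r x / p x))" "integrable \<mu> (\<lambda>x. r x * ln (r x / q x))"
proof -
  have sets: "sets R = sets P" "sets R = sets Q" using R by auto
  have Q: "kl_divergence R Q \<noteq> - \<infinity>" by (rule kl_divergence_ne_MInf[OF R(1) prob_Q sets(2)])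
  then have P: "kl_divergence R P \<noteq> \<infinity>"
    using kl_mixture_eq_top[OF order_pos order_ne_1] fin by blast
  have "absolutely_continuous P R"
    by (rule kl_divergence_finite_imp_absolutely_continuous[OF R(1) prob_P sets(1) P])
  moreover have "absolutely_continuous \<mu> P"
    unfolding P_eq by (rule absolutely_continuousI_density) simp
  ultimately have "absolutely_continuous \<mu> R"
    by (auto simp: absolutely_continuous_def)
  then obtain r :: "'a \<Rightarrow> real" where r: "r \<in> borel_measurable \<mu>" "\<And>x. 0 \<le> r x"
      "R = density \<mu> (\<lambda>x. ennreal (r x))"
    using real_densityE[OF sigma_finite_measure_axioms _ _ R(2)] R(1)
    unfolding prob_space_def by metis
  have kl: "kl_divergence R P = kl_integral \<mu> r p" "kl_divergence R Q = kl_integral \<mu> r q"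
    using R(1) r(1,2) unfolding r(3) by (auto intro!: kl_divergence_density)
  have p: "AE x in \<mu>. p x = 0 \<longrightarrow> r x = 0" "integrable \<mu> (\<lambda>x. r x * ln (r x / p x))"
    using kl_integral_finiteD[OF r(1) integrable_p r(2) p_nonneg] P by (auto simp: kl)
  have int: "integrable \<mu> r"
    using R(1) r(1,2) unfolding r(3) prob_space_def by (intro integrable_density_finite) auto
  have q: "(AE x in \<mu>. q x = 0 \<longrightarrow> r x = 0) \<and> integrable \<mu> (\<lambda>x. r x * ln (r x / q x))"
  proof (cases "\<alpha> < 1")
    case True
    have "kl_divergence R Q \<noteq> \<infinity>"
    proof
      assume "kl_divergence R Q = \<infinity>"
      with True fin P kl_divergence_ne_MInf[OF R(1) prob_P sets(1)] show False
        by (cases "kl_divergence R P") (auto simp: kl_mixture_def Let_def)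
    qed
    then show ?thesis
      using kl_integral_finiteD[OF r(1) integrable_q r(2) q_nonneg] by (auto simp: kl)
  next
    case False
    with order_ne_1 have "1 < \<alpha>" by simp
    have regular using Z_eq_top fin(2) by (metis less_irrefl)
    then have "AE x in \<mu>. q x = 0 \<longrightarrow> p x = 0" using False by (simp add: regular_def)
    with p(1) have ac: "AE x in \<mu>. q x = 0 \<longrightarrow> r x = 0" by eventually_elim auto
    with integrable_kl_Q[OF \<open>1 < \<alpha>\<close> fin(2) int r(2) p(1) _ p(2)] show ?thesis by blast
  qed
  show thesis
    using that[OF r p(1) _ p(2)] q by blast
qed

text \<open>Where \<open>v\<close> is nonzero, \<open>r / w\<close> is the constant
  \<open>1 / z\<close>, so \<open>r * ln (r / w)\<close> is \<open>- ln z * r\<close> and integrates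
  to \<open>- ln z\<close>. Taking \<open>v = w\<close> gives the tilted distribution; restricting
  \<open>w\<close> to a set gives its truncations.\<close>

lemma normalized_density:
  fixes v :: "'a \<Rightarrow> real" and z :: real
  assumes v: "integrable \<mu> v" "\<And>x. v x = 0 \<or> v x = w x"
    and z: "z = (\<integral>x. v x \<partial>\<mu>)" "0 < z"
  defines "r \<equiv> \<lambda>x. v x / z"
  shows "prob_space (density \<mu> (\<lambda>x. ennreal (r x)))"
    and "integrable \<mu> (\<lambda>x. r x * ln (r x / p x)) \<Longrightarrow> integrable \<mu> (\<lambda>x. r x * ln (r x / q x)) \<Longrightarrow>
      kl_mixture \<alpha> P Q (density \<mu> (\<lambda>x. ennreal (r x))) = ereal (- ln z)"
proof -
  have [measurable]: "r \<in> borel_measurable \<mu>" unfolding r_def using v by simp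
  have nonneg: "0 \<le> r x" for x using z(2) v(2)[of x] by (auto simp: r_def w_nonneg)
  have int: "integrable \<mu> r" "(\<integral>x. r x \<partial>\<mu>) = 1"
    unfolding r_def using v z by simp_all
  show prob: "prob_space (density \<mu> (\<lambda>x. ennreal (r x)))"
  proof (rule prob_spaceI)
    have "(\<integral>\<^sup>+ x. ennreal (r x) \<partial>\<mu>) = 1"
      using int nonneg by (subst nn_integral_eq_integral) auto
    then show "emeasure (density \<mu> (\<lambda>x. ennreal (r x))) (space (density \<mu> (\<lambda>x. ennreal (r x)))) = 1"
      by (simp add: emeasure_density cong: nn_integral_cong)
  qed
  have "r x = 0" if "p x = 0 \<or> q x = 0" for x
    using v(2)[of x] that by (auto simp: r_def w_def)
  then have ac: "AE x in \<mu>. p x = 0 \<longrightarrow> r x = 0" "AE x in \<mu>. q x = 0 \<longrightarrow> r x = 0"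
    by simp_all
  have eq: "r x * ln (r x / w x) = - ln z * r x" for x
  proof (cases "v x = 0")
    case False
    with v(2)[of x] have "r x / w x = 1 / z" by (auto simp: r_def)
    then show ?thesis using z(2) by (simp add: ln_div)
  qed (simp add: r_def)
  assume "integrable \<mu> (\<lambda>x. r x * ln (r x / p x))" "integrable \<mu> (\<lambda>x. r x * ln (r x / q x))"
  from kl_mixture_density(2)[OF _ nonneg prob ac this]
  show "kl_mixture \<alpha> P Q (density \<mu> (\<lambda>x. ennreal (r x))) = ereal (- ln z)"
    unfolding eq using int by simp
qed

section \<open>Lower bound and uniqueness\<close>

lemma kl_mixture_lower_bound:
  assumes R: "prob_space R" "sets R = sets \<mu>"
  shows "- ln_ennreal Z \<le> kl_mixture \<alpha> P Q R"
    and "0 < Z \<Longrightarrow> Z < \<infinity> \<Longrightarrow> kl_mixture \<alpha> P Q R = - ln_ennreal Z \<Longrightarrow>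
      R = density \<mu> (\<lambda>x. ennreal (w x / enn2real Z))"
proof -
  \<comment> \<open>One computation yields both claims: the gap in the inequality is the integral of
    a nonnegative function whose vanishing identifies \<open>R\<close>.\<close>
  have "- ln_ennreal Z \<le> kl_mixture \<alpha> P Q R \<and> (0 < Z \<and> kl_mixture \<alpha> P Q R = - ln_ennreal Z \<longrightarrow>
      R = density \<mu> (\<lambda>x. ennreal (w x / enn2real Z)))"
    if fin: "Z < \<infinity>" "kl_mixture \<alpha> P Q R \<noteq> \<infinity>"
  proof -
    define z where "z = (\<integral>x. w x \<partial>\<mu>)"
    note w = integrable_w[OF fin(1), folded z_def]
    have "0 \<le> z" unfolding z_def by (intro integral_nonneg_AE AE_I2 w_nonneg)
    obtain r where r: "r \<in> borel_measurable \<mu>" "\<And>x. 0 \<le> r x"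
      "R = density \<mu> (\<lambda>x. ennreal (r x))"
      "AE x in \<mu>. p x = 0 \<longrightarrow> r x = 0" "AE x in \<mu>. q x = 0 \<longrightarrow> r x = 0"
      "integrable \<mu> (\<lambda>x. r x * ln (r x / p x))" "integrable \<mu> (\<lambda>x. r x * ln (r x / q x))"
      by (rule kl_mixture_finiteE[OF R fin(2,1)]) (rule that)
    have [measurable]: "r \<in> borel_measurable \<mu>" by fact
    have prob: "prob_space (density \<mu> (\<lambda>x. ennreal (r x)))" using R(1) by (simp add: r(3))
    have int: "integrable \<mu> r"
      using prob r(1,2) unfolding prob_space_def by (intro integrable_density_finite) auto
    have "ennreal (\<integral>x. r x \<partial>\<mu>) = (\<integral>\<^sup>+ x. ennreal (r x) \<partial>\<mu>)"
      using int r(2) by (intro nn_integral_eq_integral[symmetric]) auto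
    also have "\<dots> = emeasure R (space R)"
      by (simp add: r(3) emeasure_density cong: nn_integral_cong)
    also have "\<dots> = ennreal 1" using prob_space.emeasure_space_1[OF R(1)] by simp
    finally have one: "(\<integral>x. r x \<partial>\<mu>) = 1"
      by (subst (asm) ennreal_inj) (auto intro: integral_nonneg_AE simp: r(2))
    have w0: "AE x in \<mu>. w x = 0 \<longrightarrow> r x = 0"
      using r(4,5) by eventually_elim (auto simp: w_eq_0_iff)
    \<comment> \<open>With \<open>z = 0\<close> the density \<open>r\<close> would vanish almost
      everywhere. This matches the bound \<open>\<infinity>\<close> obtained for
      \<open>Z = 0\<close>: every mixture is then \<open>\<infinity>\<close>.\<close>
    have "z \<noteq> 0"
    proof
      assume "z = 0"
      then have "AE x in \<mu>. w x = 0"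
        using w(1) w_nonneg unfolding z_def by (subst (asm) integral_nonneg_eq_0_iff_AE) auto
      with w0 have "AE x in \<mu>. r x = 0" by eventually_elim auto
      then have "(\<integral>x. r x \<partial>\<mu>) = 0" by (intro integral_eq_zero_AE)
      with one show False by simp
    qed
    with \<open>0 \<le> z\<close> have z: "0 < z" by simp
    have lnZ: "ln_ennreal Z = ereal (ln z)" using z by (simp add: ln_ennreal_def w(2))
    have mix: "integrable \<mu> (\<lambda>x. r x * ln (r x / w x))"
      "kl_mixture \<alpha> P Q R = ereal (\<integral>x. r x * ln (r x / w x) \<partial>\<mu>)"
      using kl_mixture_density[OF r(1,2) prob r(4-7)] by (simp_all flip: r(3))
    define s where "s = (\<lambda>x. w x / z)"
    have s: "s \<in> borel_measurable \<mu>" "integrable \<mu> s" "(\<integral>x. s x \<partial>\<mu>) = 1" "\<And>x. 0 \<le> s x"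
      using w z by (simp_all add: s_def w_nonneg flip: z_def)
    have [measurable]: "s \<in> borel_measurable \<mu>" by fact
    \<comment> \<open>This is the Gibbs gap between \<open>r\<close> and \<open>s\<close> with
      \<open>ln z\<close> split off, so that it integrates term by term; \<open>- r x + s x\<close>
      contributes 0, as both densities have mass 1.\<close>
    let ?h = "\<lambda>x. r x * ln (r x / w x) + ln z * r x - r x + s x"
    have eq: "AE x in \<mu>. ?h x = r x * ln (r x / s x) - (r x - s x)"
      using w0
    proof eventually_elim
      case (elim x)
      show ?case
      proof (cases "r x = 0")
        case False
        with elim r(2)[of x] w_nonneg[of x] have "0 < r x" "0 < w x" by auto
        then show ?thesis using z by (simp add: s_def ln_div ln_mult algebra_simps)
      qed simp
    qed
    have s0: "AE x in \<mu>. s x = 0 \<longrightarrow> r x = 0"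
      using w0 z by (auto simp: s_def)
    have pos: "AE x in \<mu>. 0 \<le> ?h x"
      using eq s0
    proof eventually_elim
      case (elim x)
      then show ?case using diff_le_mult_ln[of "r x" "s x"] r(2) s(4) by simp
    qed
    have h: "integrable \<mu> ?h" "(\<integral>x. ?h x \<partial>\<mu>) = (\<integral>x. r x * ln (r x / w x) \<partial>\<mu>) + ln z"
      using mix int s one by simp_all
    have "0 \<le> (\<integral>x. ?h x \<partial>\<mu>)" using pos by (rule integral_nonneg_AE)
    then have le: "- ln_ennreal Z \<le> kl_mixture \<alpha> P Q R"
      unfolding lnZ mix(2) h(2) by simp
    have "R = density \<mu> (\<lambda>x. ennreal (w x / enn2real Z))" if "kl_mixture \<alpha> P Q R = - ln_ennreal Z"
    proof -
      have "(\<integral>x. ?h x \<partial>\<mu>) = 0" using that unfolding h(2) lnZ mix(2) by simp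
      then have "AE x in \<mu>. ?h x = 0"
        using h(1) pos by (subst (asm) integral_nonneg_eq_0_iff_AE) auto
      with eq s0 have "AE x in \<mu>. r x = s x"
      proof eventually_elim
        case (elim x)
        then show ?case using mult_ln_eq_diff_iff[of "r x" "s x"] r(2) s(4) by simp
      qed
      then have "density \<mu> (\<lambda>x. ennreal (r x)) = density \<mu> (\<lambda>x. ennreal (s x))"
        by (intro density_cong) auto
      then show ?thesis using \<open>0 \<le> z\<close> by (simp add: r(3) s_def w(2))
    qed
    with le show ?thesis by blast
  qed
  note * = this
  show "- ln_ennreal Z \<le> kl_mixture \<alpha> P Q R"
    \<comment> \<open>In the remaining cases the left side is \<open>- \<infinity>\<close> or the
      right side is \<open>\<infinity>\<close>.\<close>
    using * by (cases "Z = \<infinity>"; cases "kl_mixture \<alpha> P Q R = \<infinity>")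
      (auto simp: ln_ennreal_def less_top)
  show "R = density \<mu> (\<lambda>x. ennreal (w x / enn2real Z))"
    if "0 < Z" "Z < \<infinity>" "kl_mixture \<alpha> P Q R = - ln_ennreal Z"
  proof -
    have "- ln_ennreal Z \<noteq> \<infinity>"
      using that(1,2) by (auto simp: ln_ennreal_def)
    then show ?thesis using that * by simp
  qed
qed

section \<open>Upper bound by truncation\<close>

lemma kl_mixture_P:
  assumes "\<not> regular"
  shows "kl_mixture \<alpha> P Q P = - \<infinity>"
proof -
  have \<alpha>: "1 < \<alpha>" and nac: "\<not> (AE x in \<mu>. q x = 0 \<longrightarrow> p x = 0)"
    using assms order_ne_1 by (auto simp: regular_def)
  have zero: "(\<lambda>x. p x * ln (p x / p x)) = (\<lambda>x. 0)" by auto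
  have "kl_divergence P P = kl_integral \<mu> p p"
    using kl_divergence_density(1)[OF p_measurable p_nonneg] prob_P by (simp flip: P_eq)
  also have "\<dots> = 0"
    by (subst kl_integral_eq_integral; (subst zero)?) (simp_all add: zero_ereal_def)
  finally have PP: "kl_divergence P P = 0" .
  have "kl_divergence P Q = kl_integral \<mu> p q"
    using kl_divergence_density(2)[OF p_measurable p_nonneg] prob_P by (simp flip: P_eq)
  also have "\<dots> = \<infinity>"
    using kl_integral_finiteD(1)[OF p_measurable integrable_q p_nonneg q_nonneg] nac by blast
  \<comment> \<open>The infinite divergence from \<open>Q\<close> carries the negative coefficient
    \<open>1 - \<alpha>\<close>, and the other term is 0.\<close>
  finally show ?thesis using \<alpha> PP by (simp add: kl_mixture_def)
qed

text \<open>These forms turn a bound on the log-ratio of \<open>p\<close> and \<open>q\<close> into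
  bounds on \<open>w / p\<close> and \<open>w / q\<close>.\<close>

lemma w_eq_exp:
  assumes "0 < p x" "0 < q x"
  shows "w x = p x * exp ((1 - \<alpha>) * ln (q x / p x))"
    and "w x = q x * exp (\<alpha> * ln (p x / q x))"
proof -
  have "p x * exp ((1 - \<alpha>) * ln (q x / p x)) = exp (ln (p x) + (1 - \<alpha>) * ln (q x / p x))"
    "q x * exp (\<alpha> * ln (p x / q x)) = exp (ln (q x) + \<alpha> * ln (p x / q x))"
    using assms by (simp_all add: exp_add)
  moreover have "w x = exp (\<alpha> * ln (p x) + (1 - \<alpha>) * ln (q x))"
    using assms by (simp add: w_def powr_def exp_add)
  ultimately show "w x = p x * exp ((1 - \<alpha>) * ln (q x / p x))"
    "w x = q x * exp (\<alpha> * ln (p x / q x))"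
    using assms by (simp_all add: ln_div algebra_simps)
qed

text \<open>The log-ratio of \<open>p\<close> and \<open>q\<close> is at most \<open>ln n\<close> in
  absolute value here, and the sets grow to the part of the space where \<open>w\<close> is
  nonzero.\<close>

definition ratio_bounded :: "nat \<Rightarrow> 'a set" where
  "ratio_bounded n = {x \<in> space \<mu>. 0 < p x \<and> 0 < q x \<and> p x \<le> n * q x \<and> q x \<le> n * p x}"

lemma ratio_bounded_sets [measurable]: "ratio_bounded n \<in> sets \<mu>"
  unfolding ratio_bounded_def by measurable

lemma incseq_ratio_bounded: "incseq ratio_bounded"
proof (rule incseq_SucI)
  fix n
  have "real n * t \<le> real (Suc n) * t" if "0 < t" for t using that by simp
  then show "ratio_bounded n \<subseteq> ratio_bounded (Suc n)"
    unfolding ratio_bounded_def by (blast intro: order_trans)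
qed

lemma UN_ratio_bounded: "(\<Union>n. ratio_bounded n) = {x \<in> space \<mu>. 0 < p x \<and> 0 < q x}"
proof -
  have "\<exists>n::nat. p x \<le> n * q x \<and> q x \<le> n * p x" if pos: "0 < p x" "0 < q x" for x
  proof -
    obtain n :: nat where "max (p x / q x) (q x / p x) \<le> n" using real_arch_simple by blast
    with pos show ?thesis by (auto simp: pos_divide_le_eq)
  qed
  then show ?thesis by (auto simp: ratio_bounded_def)
qed

lemma abs_ln_ratio_le:
  assumes "x \<in> ratio_bounded n"
  shows "\<bar>ln (q x / p x)\<bar> \<le> ln n" "\<bar>ln (p x / q x)\<bar> \<le> ln n"
proof -
  have *: "0 < p x" "0 < q x" "p x \<le> n * q x" "q x \<le> n * p x"
    using assms by (auto simp: ratio_bounded_def)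
  \<comment> \<open>\<open>n = 0\<close> would force \<open>p x \<le> 0\<close>.\<close>
  then have n: "0 < real n" by (cases n) auto
  have "ln (p x) \<le> ln (n * q x)" "ln (q x) \<le> ln (n * p x)"
    using * n by (simp_all add: ln_le_cancel_iff)
  with * n show "\<bar>ln (q x / p x)\<bar> \<le> ln n" "\<bar>ln (p x / q x)\<bar> \<le> ln n"
    by (auto simp: ln_div ln_mult)
qed

text \<open>On the truncation set \<open>w\<close> is at most a constant times \<open>p\<close>, so
  the truncated integral is finite even when \<open>Z = \<infinity>\<close>.\<close>

lemma integrable_w_ratio_bounded: "integrable \<mu> (\<lambda>x. indicator (ratio_bounded n) x * w x)"
proof (rule integrable_sandwich)
  let ?C = "exp (\<bar>1 - \<alpha>\<bar> * ln n)"
  show "integrable \<mu> (\<lambda>x. 0::real)" by simp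
  show "integrable \<mu> (\<lambda>x. ?C * p x)" using integrable_p by simp
  show "AE x in \<mu>. 0 \<le> indicator (ratio_bounded n) x * w x" by (simp add: w_nonneg)
  show "AE x in \<mu>. indicator (ratio_bounded n) x * w x \<le> ?C * p x"
    using AE_space
  proof eventually_elim
    case (elim x)
    show ?case
    proof (cases "x \<in> ratio_bounded n")
      case True
      then have pos: "0 < p x" "0 < q x" by (auto simp: ratio_bounded_def)
      have "(1 - \<alpha>) * ln (q x / p x) \<le> \<bar>1 - \<alpha>\<bar> * \<bar>ln (q x / p x)\<bar>"
        by (metis abs_ge_self abs_mult)
      also have "\<dots> \<le> \<bar>1 - \<alpha>\<bar> * ln n"
        using abs_ln_ratio_le[OF True] by (intro mult_left_mono) auto
      finally show ?thesis using True pos by (simp add: w_eq_exp(1) mult.commute)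
    qed (use p_nonneg[OF elim] in simp)
  qed
qed simp

text \<open>On the support of \<open>r\<close>, both \<open>ln (r / p)\<close> and
  \<open>ln (r / q)\<close> are a bounded multiple of a log-ratio shifted by \<open>ln z\<close>, so
  both divergences are finite.\<close>

lemma kl_mixture_ratio_bounded:
  assumes z: "z = (\<integral>x. indicator (ratio_bounded n) x * w x \<partial>\<mu>)" "0 < z"
  defines "r \<equiv> \<lambda>x. indicator (ratio_bounded n) x * w x / z"
  shows "kl_mixture \<alpha> P Q (density \<mu> (\<lambda>x. ennreal (r x))) = ereal (- ln z)"
proof -
  have v: "indicator (ratio_bounded n) x * w x = 0 \<or> indicator (ratio_bounded n) x * w x = w x" for x
    by (simp add: indicator_def)
  have [measurable]: "r \<in> borel_measurable \<mu>" unfolding r_def by measurable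
  have nonneg: "0 \<le> r x" for x using z(2) by (simp add: r_def w_nonneg)
  have r: "integrable \<mu> r"
    unfolding r_def using integrable_w_ratio_bounded by simp
  \<comment> \<open>Since \<open>r\<close> vanishes off the truncation set, a bound \<open>c\<close>
    on the logarithm there gives the dominating function \<open>c * r\<close>. It is applied with
    \<open>s = p\<close> and \<open>s = q\<close>.\<close>
  have bound: "integrable \<mu> (\<lambda>x. r x * ln (r x / s x))"
    if [measurable]: "s \<in> borel_measurable \<mu>"
      and b: "\<And>x. x \<in> ratio_bounded n \<Longrightarrow> \<bar>ln (w x / z / s x)\<bar> \<le> c" for s :: "'a \<Rightarrow> real" and c
  proof (rule Bochner_Integration.integrable_bound[where f = "\<lambda>x. c * r x"])
    show "integrable \<mu> (\<lambda>x. c * r x)" using r by simp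
    have "norm (r x * ln (r x / s x)) \<le> norm (c * r x)" for x
    proof (cases "x \<in> ratio_bounded n")
      case True
      have "\<bar>r x * ln (r x / s x)\<bar> = r x * \<bar>ln (r x / s x)\<bar>"
        using nonneg[of x] by (simp add: abs_mult)
      also have "\<dots> = r x * \<bar>ln (w x / z / s x)\<bar>"
        using True by (simp add: r_def)
      also have "\<dots> \<le> r x * c" using b[OF True] nonneg by (rule mult_left_mono)
      finally show ?thesis by (simp add: mult.commute)
    qed (simp add: r_def)
    then show "AE x in \<mu>. norm (r x * ln (r x / s x)) \<le> norm (c * r x)" by simp
  qed simp
  have "integrable \<mu> (\<lambda>x. r x * ln (r x / p x))"
  proof (rule bound)
    fix x assume x: "x \<in> ratio_bounded n"
    then have pos: "0 < p x" "0 < q x" by (auto simp: ratio_bounded_def)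
    have "ln (w x / z / p x) = (1 - \<alpha>) * ln (q x / p x) - ln z"
      using pos z(2) by (simp add: w_eq_exp(1) ln_div)
    also have "\<bar>\<dots>\<bar> \<le> \<bar>1 - \<alpha>\<bar> * \<bar>ln (q x / p x)\<bar> + \<bar>ln z\<bar>"
      by (metis abs_triangle_ineq4 abs_mult)
    also have "\<dots> \<le> \<bar>1 - \<alpha>\<bar> * ln n + \<bar>ln z\<bar>"
      using abs_ln_ratio_le[OF x] by (intro add_right_mono mult_left_mono) auto
    finally show "\<bar>ln (w x / z / p x)\<bar> \<le> \<bar>1 - \<alpha>\<bar> * ln n + \<bar>ln z\<bar>" .
  qed simp
  moreover have "integrable \<mu> (\<lambda>x. r x * ln (r x / q x))"
  proof (rule bound)
    fix x assume x: "x \<in> ratio_bounded n"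
    then have pos: "0 < p x" "0 < q x" by (auto simp: ratio_bounded_def)
    have "ln (w x / z / q x) = \<alpha> * ln (p x / q x) - ln z"
      using pos z(2) by (simp add: w_eq_exp(2) ln_div)
    also have "\<bar>\<dots>\<bar> \<le> \<bar>\<alpha>\<bar> * \<bar>ln (p x / q x)\<bar> + \<bar>ln z\<bar>"
      by (metis abs_triangle_ineq4 abs_mult)
    also have "\<dots> \<le> \<bar>\<alpha>\<bar> * ln n + \<bar>ln z\<bar>"
      using abs_ln_ratio_le[OF x] by (intro add_right_mono mult_left_mono) auto
    finally show "\<bar>ln (w x / z / q x)\<bar> \<le> \<bar>\<alpha>\<bar> * ln n + \<bar>ln z\<bar>" .
  qed simp
  ultimately show ?thesis
    unfolding r_def by (rule normalized_density(2)[OF integrable_w_ratio_bounded v z])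
qed

text \<open>Continuity from below of the measure with density \<open>w\<close>, which gives no mass
  to the complement of the union.\<close>

lemma Z_eq_SUP:
  assumes regular
  shows "Z = (SUP n. \<integral>\<^sup>+ x. ennreal (indicator (ratio_bounded n) x * w x) \<partial>\<mu>)"
proof -
  let ?W = "density \<mu> (\<lambda>x. ennreal (w x))"
  have ind: "ennreal (indicator A x * w x) = ennreal (w x) * indicator A x" for A x
    by (simp add: indicator_def)
  have "(SUP n. emeasure ?W (ratio_bounded n)) = emeasure ?W (\<Union>n. ratio_bounded n)"
    using incseq_ratio_bounded by (intro SUP_emeasure_incseq) auto
  also have "\<dots> = (\<integral>\<^sup>+ x. ennreal (w x) * indicator {x \<in> space \<mu>. 0 < p x \<and> 0 < q x} x \<partial>\<mu>)"
    unfolding UN_ratio_bounded by (subst emeasure_density) auto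
  also have "\<dots> = (\<integral>\<^sup>+ x. ennreal (w x) \<partial>\<mu>)"
  proof (rule nn_integral_cong)
    fix x assume x: "x \<in> space \<mu>"
    show "ennreal (w x) * indicator {x \<in> space \<mu>. 0 < p x \<and> 0 < q x} x = ennreal (w x)"
      using x p_nonneg[OF x] q_nonneg[OF x] w_eq_0_iff[of x] by (auto simp: indicator_def less_le)
  qed
  also have "\<dots> = Z" using Z_eq[OF assms] by simp
  finally show ?thesis by (simp add: ind emeasure_density)
qed

abbreviation distributions :: "'a measure set" where
  "distributions \<equiv> {R. prob_space R \<and> sets R = sets \<mu>}"

lemma INF_kl_mixture: "(INF R \<in> distributions. kl_mixture \<alpha> P Q R) = - ln_ennreal Z"
proof (rule antisym)
  let ?I = "INF R \<in> distributions. kl_mixture \<alpha> P Q R"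
  show "- ln_ennreal Z \<le> ?I"
    by (rule INF_greatest) (auto intro: kl_mixture_lower_bound)
  show "?I \<le> - ln_ennreal Z"
  proof (cases regular)
    case False
    have "?I \<le> kl_mixture \<alpha> P Q P"
      using prob_P by (intro INF_lower) simp
    with kl_mixture_P[OF False] show ?thesis by simp
  next
    case True
    \<comment> \<open>Negating the goal puts the supremum inside the logarithm on the left, so each
      truncation can be treated separately.\<close>
    have "ln_ennreal Z \<le> - ?I"
      unfolding Z_eq_SUP[OF True]
    proof (rule ln_ennreal_SUP_le)
      fix n
      define z where "z = (\<integral>x. indicator (ratio_bounded n) x * w x \<partial>\<mu>)"
      have eq: "(\<integral>\<^sup>+ x. ennreal (indicator (ratio_bounded n) x * w x) \<partial>\<mu>) = ennreal z"
        unfolding z_def using integrable_w_ratio_bounded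
        by (intro nn_integral_eq_integral) (simp_all add: w_nonneg)
      have "ln_ennreal (ennreal z) \<le> - ?I"
      proof (cases "0 < z")
        case z: True
        have r: "prob_space (density \<mu> (\<lambda>x. ennreal (indicator (ratio_bounded n) x * w x / z)))"
          by (rule normalized_density(1)[OF integrable_w_ratio_bounded _ z_def z])
            (simp add: indicator_def)
        have "?I \<le> ereal (- ln z)"
          unfolding kl_mixture_ratio_bounded[OF z_def z, symmetric]
          using r by (intro INF_lower) simp
        then have "ereal (ln z) \<le> - ?I"
          by (metis ereal_minus_le_minus ereal_uminus_uminus uminus_ereal.simps(1))
        then show ?thesis using z by (simp add: ln_ennreal_def)
      next
        \<comment> \<open>No normalization exists when the truncated integral is 0, but its
          logarithm is then \<open>- \<infinity>\<close>.\<close>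
        case False
        then show ?thesis by (simp add: ln_ennreal_def ennreal_neg)
      qed
      then show "ln_ennreal (\<integral>\<^sup>+ x. ennreal (indicator (ratio_bounded n) x * w x) \<partial>\<mu>) \<le> - ?I"
        by (simp add: eq)
    qed
    then show ?thesis by (metis ereal_minus_le_minus ereal_uminus_uminus)
  qed
qed

section \<open>The scaled divergence and the minimizer\<close>

lemma renyi_divergence_scaled: "ereal (1 - \<alpha>) * renyi_divergence \<alpha> P Q = - ln_ennreal Z"
proof -
  have "renyi_divergence \<alpha> P Q = ereal (1 / (\<alpha> - 1)) * ln_ennreal Z"
    using prob_P prob_Q p_nonneg q_nonneg order_pos order_ne_1
    by (intro renyi_divergence_eq sigma_finite_measure_axioms P_eq Q_eq)
      (auto simp: prob_space_def)
  moreover have "(1 - \<alpha>) * (1 / (\<alpha> - 1)) = - 1"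
    using order_ne_1 by (simp add: field_simps)
  \<comment> \<open>Associativity in \<open>ereal\<close> lets the real prefactors cancel first, so
    infinite logarithms are covered as well.\<close>
  ultimately show ?thesis
    by (simp add: mult.assoc[symmetric] flip: one_ereal_def uminus_ereal.simps(1))
qed

lemma tilted_distribution_eq:
  assumes "0 < Z" "Z < \<infinity>"
  shows "tilted_distribution \<mu> \<alpha> p q = density \<mu> (\<lambda>x. ennreal (w x / enn2real Z))"
  unfolding tilted_distribution_def
proof (rule density_cong)
  have regular using assms Z_eq_top by (metis less_irrefl)
  from AE_renyi_integrand[OF this]
  show "AE x in \<mu>. renyi_integrand \<alpha> (p x) (q x) / Z = ennreal (w x / enn2real Z)"
  proof eventually_elim
    case (elim x)
    obtain z where "Z = ennreal z" "0 < z" using assms by (cases Z) (auto simp: ennreal_less_zero_iff)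
    then show ?case using elim by (simp add: divide_ennreal w_nonneg)
  qed
qed measurable

text \<open>The mixed integrand is always \<open>- ln z * r\<close>; the issue is integrability of
  its two terms. For \<open>\<alpha> < 1\<close> both have positive coefficients and Gibbs lower
  bounds, so an integrable sum makes each integrable. For \<open>\<alpha> > 1\<close> the assumption
  settles the term for \<open>P\<close>, and \<open>integrable_kl_Q\<close> the term for
  \<open>Q\<close>.\<close>

lemma kl_mixture_tilted:
  assumes Z: "0 < Z" "Z < \<infinity>"
    and D: "\<alpha> < 1 \<or> kl_divergence (tilted_distribution \<mu> \<alpha> p q) P < \<infinity>"
  shows "prob_space (tilted_distribution \<mu> \<alpha> p q)"
    and "kl_mixture \<alpha> P Q (tilted_distribution \<mu> \<alpha> p q) = - ln_ennreal Z"
proof -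
  define z where "z = (\<integral>x. w x \<partial>\<mu>)"
  note w = integrable_w[OF Z(2), folded z_def]
  have z: "0 < z" using Z w(2) by simp
  define r where "r = (\<lambda>x. w x / z)"
  have T: "tilted_distribution \<mu> \<alpha> p q = density \<mu> (\<lambda>x. ennreal (r x))"
    using z by (simp add: tilted_distribution_eq[OF Z] w(2) r_def)
  have nonneg: "0 \<le> r x" for x using z by (simp add: r_def w_nonneg)
  have r: "integrable \<mu> r" unfolding r_def using w by simp
  then have [measurable]: "r \<in> borel_measurable \<mu>" by simp
  show prob: "prob_space (tilted_distribution \<mu> \<alpha> p q)"
    unfolding T r_def by (rule normalized_density(1)[OF w(1) _ z_def z]) simp
  have ac: "AE x in \<mu>. p x = 0 \<longrightarrow> r x = 0" "AE x in \<mu>. q x = 0 \<longrightarrow> r x = 0"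
    by (auto simp: r_def w_def)
  have mixed: "\<alpha> * (r x * ln (r x / p x)) + (1 - \<alpha>) * (r x * ln (r x / q x)) = - ln z * r x"
    if "x \<in> space \<mu>" for x
  proof -
    have "r x * ln (r x / w x) = - ln z * r x"
      using z by (cases "w x = 0") (auto simp: r_def ln_div)
    with mixed_kl_integrand[OF that nonneg[of x]] show ?thesis
      by (simp add: r_def w_eq_0_iff)
  qed
  have int: "integrable \<mu> (\<lambda>x. r x * ln (r x / p x)) \<and> integrable \<mu> (\<lambda>x. r x * ln (r x / q x))"
  proof (cases "\<alpha> < 1")
    case True
    have p: "integrable \<mu> (\<lambda>x. r x * ln (r x / p x))"
    proof (rule integrable_sandwich)
      show "integrable \<mu> (\<lambda>x. r x - p x)" using r integrable_p by simp
      \<comment> \<open>The upper bound solves \<open>mixed\<close> for the \<open>P\<close> term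
        after replacing the \<open>Q\<close> term by its lower bound
        \<open>r x - q x\<close>.\<close>
      show "integrable \<mu> (\<lambda>x. (- ln z * r x - (1 - \<alpha>) * (r x - q x)) / \<alpha>)"
        using r integrable_q by simp
      show "AE x in \<mu>. r x - p x \<le> r x * ln (r x / p x)"
        using ac AE_space by eventually_elim (auto intro: diff_le_mult_ln nonneg p_nonneg)
      show "AE x in \<mu>. r x * ln (r x / p x) \<le> (- ln z * r x - (1 - \<alpha>) * (r x - q x)) / \<alpha>"
        using ac AE_space
      proof eventually_elim
        case (elim x)
        have "r x - q x \<le> r x * ln (r x / q x)"
          using elim by (intro diff_le_mult_ln nonneg q_nonneg) auto
        then have "(1 - \<alpha>) * (r x - q x) \<le> (1 - \<alpha>) * (r x * ln (r x / q x))"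
          using True by (intro mult_left_mono) auto
        then have "\<alpha> * (r x * ln (r x / p x)) \<le> - ln z * r x - (1 - \<alpha>) * (r x - q x)"
          using mixed[OF elim(3)] by linarith
        then show ?case using order_pos by (simp add: pos_le_divide_eq mult.commute)
      qed
    qed simp
    have "integrable \<mu> (\<lambda>x. (- ln z * r x - \<alpha> * (r x * ln (r x / p x))) / (1 - \<alpha>))"
      using p r by simp
    moreover have "(- ln z * r x - \<alpha> * (r x * ln (r x / p x))) / (1 - \<alpha>) = r x * ln (r x / q x)"
      if "x \<in> space \<mu>" for x
      unfolding mixed[OF that, symmetric] using True by simp
    ultimately have "integrable \<mu> (\<lambda>x. r x * ln (r x / q x))"
      by (simp cong: Bochner_Integration.integrable_cong)
    with p show ?thesis by simp
  next
    case False
    with order_ne_1 have \<alpha>: "1 < \<alpha>" by simp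
    have "kl_divergence (tilted_distribution \<mu> \<alpha> p q) P = kl_integral \<mu> r p"
      using prob nonneg unfolding T by (intro kl_divergence_density(1)) auto
    with D False have "kl_integral \<mu> r p \<noteq> \<infinity>" by auto
    then have p: "integrable \<mu> (\<lambda>x. r x * ln (r x / p x))"
      using kl_integral_finiteD(2)[of r \<mu> p] integrable_p nonneg p_nonneg by simp
    with integrable_kl_Q[OF \<alpha> Z(2) r nonneg ac] show ?thesis by simp
  qed
  have lnZ: "- ln_ennreal Z = ereal (- ln z)" using z by (simp add: ln_ennreal_def w(2))
  show "kl_mixture \<alpha> P Q (tilted_distribution \<mu> \<alpha> p q) = - ln_ennreal Z"
    unfolding T lnZ using int unfolding r_def
    by (intro normalized_density(2)[OF w(1) _ z_def z]) auto
qed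

end

theorem theorem30:
  fixes P Q \<mu> :: "'a measure" and p q :: "'a \<Rightarrow> real" and \<alpha> :: real
  assumes "sigma_finite_measure \<mu>"
    and "p \<in> borel_measurable \<mu>" and "\<forall>x\<in>space \<mu>. 0 \<le> p x"
    and "q \<in> borel_measurable \<mu>" and "\<forall>x\<in>space \<mu>. 0 \<le> q x"
    and "prob_space P" and "P = density \<mu> (\<lambda>x. ennreal (p x))"
    and "prob_space Q" and "Q = density \<mu> (\<lambda>x. ennreal (q x))"
    and "\<alpha> \<in> {0<..<1} \<union> {1<..}"
  shows
    "ereal (1 - \<alpha>) * renyi_divergence \<alpha> P Q =
       (INF R \<in> {R. prob_space R \<and> sets R = sets \<mu>}. kl_mixture \<alpha> P Q R)
     \<and>
     (0 < renyi_integral \<mu> \<alpha> p q \<and> renyi_integral \<mu> \<alpha> p q < \<infinity> \<and>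
      (\<alpha> \<in> {0<..<1} \<or> kl_divergence (tilted_distribution \<mu> \<alpha> p q) P < \<infinity>) \<longrightarrow>
        prob_space (tilted_distribution \<mu> \<alpha> p q) \<and>
        kl_mixture \<alpha> P Q (tilted_distribution \<mu> \<alpha> p q) =
          (INF R \<in> {R. prob_space R \<and> sets R = sets \<mu>}. kl_mixture \<alpha> P Q R) \<and>
        (\<forall>R. prob_space R \<longrightarrow> sets R = sets \<mu> \<longrightarrow>
           kl_mixture \<alpha> P Q R =
             (INF R' \<in> {R. prob_space R \<and> sets R = sets \<mu>}. kl_mixture \<alpha> P Q R') \<longrightarrow>
           R = tilted_distribution \<mu> \<alpha> p q))"
proof -
  interpret renyi_pair \<mu> P Q p q \<alpha>
    using assms by (auto simp: renyi_pair_def renyi_pair_axioms_def)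
  let ?T = "tilted_distribution \<mu> \<alpha> p q"
  have tilted: "prob_space ?T \<and> kl_mixture \<alpha> P Q ?T = - ln_ennreal Z \<and>
      (\<forall>R. prob_space R \<longrightarrow> sets R = sets \<mu> \<longrightarrow> kl_mixture \<alpha> P Q R = - ln_ennreal Z \<longrightarrow> R = ?T)"
    if "0 < Z" "Z < \<infinity>" "\<alpha> \<in> {0<..<1} \<or> kl_divergence ?T P < \<infinity>"
    using kl_mixture_tilted[OF that(1,2)] kl_mixture_lower_bound(2)[OF _ _ that(1,2)]
      tilted_distribution_eq[OF that(1,2)] that(3) by auto
  \<comment> \<open>The infimum and the scaled divergence both equal \<open>- ln_ennreal Z\<close>,
    so attainment and uniqueness become statements about that value.\<close>
  show ?thesis
    unfolding INF_kl_mixture renyi_divergence_scaled using tilted by blast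
qed

end
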